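(* Let $X$ be a finite regular q-cycle set, $S$ a finite non-empty set, and $(\alpha,\alpha')$ a dynamical pair with $\alpha'_{(x,y)}(s,-)\in\mathrm{Sym}_S$ for all $x,y\in X$, $s\in S$. Then $X\times_{\alpha,\alpha'}S$ is indecomposable if and only if $X$ is indecomposable and there exists $x\in X$ such that the stabilizer $$H_x:=\{h\in\mathcal{G}(X\times_{\alpha,\alpha'}S)\mid h(\{x\}\times S)=\{x\}\times S\}$$ acts transitively on $\{x\}\times S$.
   Context: A q-cycle set is a non-empty set $X$ with two binary operations $\cdot$ and $:$ such that for every $x\in X$ the map $\sigma_x:X\to X$, $y\mapsto x\cdot y$ is bijective, and for all $x,y,z\in X$: $(x\cdot y)\cdot(x\cdot z)=(y:x)\cdot(y\cdot z)$, $(x:y):(x:z)=(y\cdot x):(y:z)$, and $(x\cdot y):(x\cdot z)=(y:x)\cdot(y:z)$. It is regular if $\delta_x:X\to X$, $y\mapsto x:y$ is bijective for every $x\in X$. For a regular q-cycle set, $\mathcal{G}(X)=\langle\sigma_x,\delta_x\mid x\in X\rangle\le\mathrm{Sym}_X$, and $X$ is indecomposable if $\mathcal{G}(X)$ acts transitively on $X$. Given a q-cycle set $X$, a set $S$, and maps $\alpha:X\times X\times S\to\mathrm{Sym}_S$, $\alpha':X\times X\times S\to S^S$ (with $S^S$ the set of all maps $S\to S$), write $\alpha_{(x,y)}(s,t)$ for the value at $t$ of $\alpha_{(x,y)}(s,-):=\alpha(x,y,s)$, and similarly for $\alpha'$. The pair $(\alpha,\alpha')$ is a dynamical pair if for all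 $x,y,z\in X$ and $s,t,u\in S$: $$\alpha_{(x\cdot y,\,x\cdot z)}(\alpha_{(x,y)}(s,t),\alpha_{(x,z)}(s,u))=\alpha_{(y:x,\,y\cdot z)}(\alpha'_{(y,x)}(t,s),\alpha_{(y,z)}(t,u)),$$ $$\alpha'_{(x:y,\,x:z)}(\alpha'_{(x,y)}(s,t),\alpha'_{(x,z)}(s,u))=\alpha'_{(y\cdot x,\,y:z)}(\alpha_{(y,x)}(t,s),\alpha'_{(y,z)}(t,u)),$$ $$\alpha'_{(x\cdot y,\,x\cdot z)}(\alpha_{(x,y)}(s,t),\alpha_{(x,z)}(s,u))=\alpha_{(y:x,\,y:z)}(\alpha'_{(y,x)}(t,s),\alpha'_{(y,z)}(t,u)).$$ Then $X\times_{\alpha,\alpha'}S$ denotes the q-cycle set on $X\times S$ with $(x,s)\cdot(y,t):=(x\cdot y,\alpha_{(x,y)}(s,t))$ and $(x,s):(y,t):=(x:y,\alpha'_{(x,y)}(s,t))$; it is regular when $X$ is regular and all $\alpha'_{(x,y)}(s,-)$ are bijective. *)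

theory Defs
  imports "HOL-Algebra.Generated_Groups" "HOL-Algebra.Group_Action"
begin

record 'a q_cycle_struct = "'a partial_object" +
  dot :: "'a \<Rightarrow> 'a \<Rightarrow> 'a"  (infixl \<open>\<cdot>\<index>\<close> 70)
  colon :: "'a \<Rightarrow> 'a \<Rightarrow> 'a"  (infixl \<open>\<Colon>\<index>\<close> 70)

locale q_cycle_set =
  fixes X :: "'a q_cycle_struct" (structure)
  assumes nonempty: "carrier X \<noteq> {}"
    and dot_bij: "x \<in> carrier X \<Longrightarrow> bij_betw (\<lambda>y. x \<cdot> y) (carrier X) (carrier X)"
    and colon_closed: "\<lbrakk>x \<in> carrier X; y \<in> carrier X\<rbrakk> \<Longrightarrow> x \<Colon> y \<in> carrier X"
    and q1: "\<lbrakk>x \<in> carrier X; y \<in> carrier X; z \<in> carrier X\<rbrakk>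
      \<Longrightarrow> (x \<cdot> y) \<cdot> (x \<cdot> z) = (y \<Colon> x) \<cdot> (y \<cdot> z)"
    and q2: "\<lbrakk>x \<in> carrier X; y \<in> carrier X; z \<in> carrier X\<rbrakk>
      \<Longrightarrow> (x \<Colon> y) \<Colon> (x \<Colon> z) = (y \<cdot> x) \<Colon> (y \<Colon> z)"
    and q3: "\<lbrakk>x \<in> carrier X; y \<in> carrier X; z \<in> carrier X\<rbrakk>
      \<Longrightarrow> (x \<cdot> y) \<Colon> (x \<cdot> z) = (y \<Colon> x) \<cdot> (y \<Colon> z)"

locale regular_q_cycle_set = q_cycle_set +
  assumes colon_bij: "x \<in> carrier X \<Longrightarrow> bij_betw (\<lambda>y. x \<Colon> y) (carrier X) (carrier X)"

definition sigma :: "'a q_cycle_struct \<Rightarrow> 'a \<Rightarrow> 'a \<Rightarrow> 'a"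
  where "sigma X x = (\<lambda>y\<in>carrier X. x \<cdot>\<^bsub>X\<^esub> y)"

definition delta :: "'a q_cycle_struct \<Rightarrow> 'a \<Rightarrow> 'a \<Rightarrow> 'a"
  where "delta X x = (\<lambda>y\<in>carrier X. x \<Colon>\<^bsub>X\<^esub> y)"

definition perm_group :: "'a q_cycle_struct \<Rightarrow> ('a \<Rightarrow> 'a) set"
  where "perm_group X =
    generate (BijGroup (carrier X)) (sigma X ` carrier X \<union> delta X ` carrier X)"

text \<open>For a set \<open>H\<close> of permutations of \<open>E\<close> and an \<open>H\<close>-invariant subset \<open>A\<close> of \<open>E\<close>, the natural
  action of \<open>H\<close> on \<open>A\<close> sends \<open>h\<close> to its restriction to \<open>A\<close>; the restriction is needed because
  the elements of \<^term>\<open>carrier (BijGroup A)\<close> are extensional functions on \<open>A\<close>.\<close>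

definition acts_transitively_on :: "'a set \<Rightarrow> ('a \<Rightarrow> 'a) set \<Rightarrow> 'a set \<Rightarrow> bool"
  where "acts_transitively_on E H A \<longleftrightarrow>
    transitive_action (BijGroup E\<lparr>carrier := H\<rparr>) A (\<lambda>h. restrict h A)"

definition indecomposable :: "'a q_cycle_struct \<Rightarrow> bool"
  where "indecomposable X \<longleftrightarrow> acts_transitively_on (carrier X) (perm_group X) (carrier X)"

locale dynamical_pair = q_cycle_set X
  for X :: "'a q_cycle_struct" (structure) and S :: "'s set"
    and \<alpha> :: "'a \<Rightarrow> 'a \<Rightarrow> 's \<Rightarrow> 's \<Rightarrow> 's" and \<alpha>' :: "'a \<Rightarrow> 'a \<Rightarrow> 's \<Rightarrow> 's \<Rightarrow> 's" +
  assumes alpha_bij: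
      "\<lbrakk>x \<in> carrier X; y \<in> carrier X; s \<in> S\<rbrakk> \<Longrightarrow> bij_betw (\<alpha> x y s) S S"
    and alpha'_closed:
      "\<lbrakk>x \<in> carrier X; y \<in> carrier X; s \<in> S\<rbrakk> \<Longrightarrow> \<alpha>' x y s \<in> S \<rightarrow> S"
    and dyn1:
      "\<lbrakk>x \<in> carrier X; y \<in> carrier X; z \<in> carrier X; s \<in> S; t \<in> S; u \<in> S\<rbrakk> \<Longrightarrow>
        \<alpha> (x \<cdot> y) (x \<cdot> z) (\<alpha> x y s t) (\<alpha> x z s u) =
        \<alpha> (y \<Colon> x) (y \<cdot> z) (\<alpha>' y x t s) (\<alpha> y z t u)"
    and dyn2:
      "\<lbrakk>x \<in> carrier X; y \<in> carrier X; z \<in> carrier X; s \<in> S; t \<in> S; u \<in> S\<rbrakk> \<Longrightarrow>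
        \<alpha>' (x \<Colon> y) (x \<Colon> z) (\<alpha>' x y s t) (\<alpha>' x z s u) =
        \<alpha>' (y \<cdot> x) (y \<Colon> z) (\<alpha> y x t s) (\<alpha>' y z t u)"
    and dyn3:
      "\<lbrakk>x \<in> carrier X; y \<in> carrier X; z \<in> carrier X; s \<in> S; t \<in> S; u \<in> S\<rbrakk> \<Longrightarrow>
        \<alpha>' (x \<cdot> y) (x \<cdot> z) (\<alpha> x y s t) (\<alpha> x z s u) =
        \<alpha> (y \<Colon> x) (y \<Colon> z) (\<alpha>' y x t s) (\<alpha>' y z t u)"

definition dyn_ext ::
  "'a q_cycle_struct \<Rightarrow> 's set \<Rightarrow> ('a \<Rightarrow> 'a \<Rightarrow> 's \<Rightarrow> 's \<Rightarrow> 's) \<Rightarrow>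
    ('a \<Rightarrow> 'a \<Rightarrow> 's \<Rightarrow> 's \<Rightarrow> 's) \<Rightarrow> ('a \<times> 's) q_cycle_struct"
  where "dyn_ext X S \<alpha> \<alpha>' =
    \<lparr>carrier = carrier X \<times> S,
     dot = (\<lambda>(x, s) (y, t). (x \<cdot>\<^bsub>X\<^esub> y, \<alpha> x y s t)),
     colon = (\<lambda>(x, s) (y, t). (x \<Colon>\<^bsub>X\<^esub> y, \<alpha>' x y s t))\<rparr>"

definition set_stabilizer :: "('a \<Rightarrow> 'a) set \<Rightarrow> 'a set \<Rightarrow> ('a \<Rightarrow> 'a) set"
  where "set_stabilizer H A = {h \<in> H. h ` A = A}"


lemma bij_betw_skew_prod:
  assumes "bij_betw f A A" "\<And>x. x \<in> A \<Longrightarrow> bij_betw (g x) S S"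
  shows "bij_betw (\<lambda>(x, s). (f x, g x s)) (A \<times> S) (A \<times> S)"
proof (rule bij_betwI')
  show "((case p of (x, s) \<Rightarrow> (f x, g x s)) = (case q of (x, s) \<Rightarrow> (f x, g x s))) = (p = q)"
    if "p \<in> A \<times> S" "q \<in> A \<times> S" for p q
    using that assms by (auto simp: bij_betw_def inj_on_def)
  show "(case p of (x, s) \<Rightarrow> (f x, g x s)) \<in> A \<times> S" if "p \<in> A \<times> S" for p
    using that assms by (auto dest: bij_betwE)
  show "\<exists>p\<in>A \<times> S. q = (case p of (x, s) \<Rightarrow> (f x, g x s))" if "q \<in> A \<times> S" for q
  proof -
    obtain y t where q: "q = (y, t)" "y \<in> A" "t \<in> S"
      using \<open>q \<in> A \<times> S\<close> by blast
    obtain x where x: "x \<in> A" "y = f x" using assms(1) q by (auto simp: bij_betw_def)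
    obtain s where "s \<in> S" "t = g x s" using assms(2)[OF x(1)] q by (auto simp: bij_betw_def)
    with q x show ?thesis by auto
  qed
qed

context q_cycle_set
begin

lemma dot_closed: "\<lbrakk>x \<in> carrier X; y \<in> carrier X\<rbrakk> \<Longrightarrow> x \<cdot> y \<in> carrier X"
  using dot_bij bij_betwE by fast

end

context dynamical_pair
begin

lemma q_cycle_set_dyn_ext:
  assumes "S \<noteq> {}"
  shows "q_cycle_set (dyn_ext X S \<alpha> \<alpha>')"
proof
  show "carrier (dyn_ext X S \<alpha> \<alpha>') \<noteq> {}"
    using nonempty assms by (auto simp: dyn_ext_def)
  show "bij_betw (\<lambda>q. p \<cdot>\<^bsub>dyn_ext X S \<alpha> \<alpha>'\<^esub> q)
      (carrier (dyn_ext X S \<alpha> \<alpha>')) (carrier (dyn_ext X S \<alpha> \<alpha>'))"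
    if "p \<in> carrier (dyn_ext X S \<alpha> \<alpha>')" for p
    using that bij_betw_skew_prod[of "\<lambda>y. fst p \<cdot> y" "carrier X" "\<lambda>y. \<alpha> (fst p) y (snd p)" S]
    by (auto simp: dyn_ext_def dot_bij alpha_bij)
qed (use alpha'_closed in
  \<open>auto simp: dyn_ext_def colon_closed q1 q2 q3 dyn1 dyn2 dyn3 Pi_iff\<close>)

lemma regular_q_cycle_set_dyn_ext:
  assumes "regular_q_cycle_set X" "S \<noteq> {}"
    and "\<And>x y s. \<lbrakk>x \<in> carrier X; y \<in> carrier X; s \<in> S\<rbrakk> \<Longrightarrow> bij_betw (\<alpha>' x y s) S S"
  shows "regular_q_cycle_set (dyn_ext X S \<alpha> \<alpha>')"
proof -
  interpret E: q_cycle_set "dyn_ext X S \<alpha> \<alpha>'"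
    by (rule q_cycle_set_dyn_ext) fact
  show ?thesis
  proof
    show "bij_betw (\<lambda>q. p \<Colon>\<^bsub>dyn_ext X S \<alpha> \<alpha>'\<^esub> q)
        (carrier (dyn_ext X S \<alpha> \<alpha>')) (carrier (dyn_ext X S \<alpha> \<alpha>'))"
      if "p \<in> carrier (dyn_ext X S \<alpha> \<alpha>')" for p
      using that assms(3) regular_q_cycle_set.colon_bij[OF assms(1)]
        bij_betw_skew_prod[of "\<lambda>y. fst p \<Colon> y" "carrier X" "\<lambda>y. \<alpha>' (fst p) y (snd p)" S]
      by (auto simp: dyn_ext_def)
  qed
qed

end

lemma (in regular_q_cycle_set) perm_group_subgroup:
  "subgroup (perm_group X) (BijGroup (carrier X))"
  unfolding perm_group_def
  by (rule group.generate_is_subgroup[OF group_BijGroup])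
    (auto simp: BijGroup_def Bij_def sigma_def delta_def dot_bij colon_bij)

lemma set_stabilizer_subgroup:
  assumes "subgroup H (BijGroup E)" "A \<subseteq> E"
  shows "subgroup (set_stabilizer H A) (BijGroup E)"
proof -
  interpret G: group "BijGroup E" by (rule group_BijGroup)
  have sub: "H \<subseteq> Bij E"
    using subgroup.subset[OF assms(1)] by (simp add: BijGroup_def)
  show ?thesis
  proof (rule G.subgroupI)
    show "set_stabilizer H A \<subseteq> carrier (BijGroup E)"
      using sub by (auto simp: set_stabilizer_def BijGroup_def)
    have "(\<lambda>x\<in>E. x) \<in> set_stabilizer H A"
      using subgroup.one_closed[OF assms(1)] assms(2)
      by (auto simp: set_stabilizer_def BijGroup_def image_def)
    then show "set_stabilizer H A \<noteq> {}" by blast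
  next
    fix h assume h: "h \<in> set_stabilizer H A"
    then have hB: "h \<in> Bij E" "h \<in> H" "h ` A = A" using sub by (auto simp: set_stabilizer_def)
    have "inv_into E h ` A = A"
      using hB(1,3) assms(2) inv_into_image_cancel[of h E A] by (auto simp: Bij_def bij_betw_def)
    then have "restrict (inv_into E h) E ` A = A"
      using assms(2) by (simp add: image_restrict_eq Int_absorb1 subset_iff)
    moreover have "inv\<^bsub>BijGroup E\<^esub> h = restrict (inv_into E h) E"
      using inv_BijGroup[OF hB(1)] by simp
    ultimately show "inv\<^bsub>BijGroup E\<^esub> h \<in> set_stabilizer H A"
      using subgroup.m_inv_closed[OF assms(1) hB(2)] by (simp add: set_stabilizer_def)
  next
    fix g h assume gh: "g \<in> set_stabilizer H A" "h \<in> set_stabilizer H A"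
    then have B: "g \<in> Bij E" "h \<in> Bij E" using sub by (auto simp: set_stabilizer_def)
    have "compose E g h ` A = g ` (h ` A)"
      using assms(2) by (auto simp: compose_def image_image intro!: image_cong)
    moreover have "g \<otimes>\<^bsub>BijGroup E\<^esub> h \<in> H"
      using gh by (intro subgroup.m_closed[OF assms(1)]) (auto simp: set_stabilizer_def)
    ultimately show "g \<otimes>\<^bsub>BijGroup E\<^esub> h \<in> set_stabilizer H A"
      using gh B by (auto simp: set_stabilizer_def BijGroup_def)
  qed
qed

text \<open>An invariant subset carries a group action, so \<^const>\<open>acts_transitively_on\<close> amounts to
  pointwise transitivity.\<close>

lemma acts_transitively_on_iff:
  assumes "subgroup H (BijGroup E)" "A \<subseteq> E" "\<And>h. h \<in> H \<Longrightarrow> h ` A = A"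
  shows "acts_transitively_on E H A \<longleftrightarrow> (\<forall>p\<in>A. \<forall>q\<in>A. \<exists>h\<in>H. h p = q)"
proof -
  interpret G: group "BijGroup E" by (rule group_BijGroup)
  have sub: "H \<subseteq> Bij E"
    using subgroup.subset[OF assms(1)] by (simp add: BijGroup_def)
  have bij: "restrict h A \<in> Bij A" if "h \<in> H" for h
    using that sub assms(2) assms(3)[of h] by (force simp: Bij_def bij_betw_def intro: inj_on_subset)
  have "group_hom (BijGroup E\<lparr>carrier := H\<rparr>) (BijGroup A) (\<lambda>h. restrict h A)"
  proof (intro group_hom.intro group_hom_axioms.intro homI)
    show "group (BijGroup E\<lparr>carrier := H\<rparr>)"
      by (rule G.subgroup_imp_group) fact
    show "group (BijGroup A)" by (rule group_BijGroup)
  next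
    fix h assume "h \<in> carrier (BijGroup E\<lparr>carrier := H\<rparr>)"
    then show "restrict h A \<in> carrier (BijGroup A)" using bij by (simp add: BijGroup_def)
  next
    fix g h assume "g \<in> carrier (BijGroup E\<lparr>carrier := H\<rparr>)" "h \<in> carrier (BijGroup E\<lparr>carrier := H\<rparr>)"
    then have gh: "g \<in> H" "h \<in> H" by auto
    have "restrict (compose E g h) A = compose A (restrict g A) (restrict h A)"
      using assms(2) assms(3)[OF gh(2)] by (auto simp: compose_def fun_eq_iff)
    then show "restrict (g \<otimes>\<^bsub>BijGroup E\<lparr>carrier := H\<rparr>\<^esub> h) A =
        restrict g A \<otimes>\<^bsub>BijGroup A\<^esub> restrict h A"
      using gh sub bij by (auto simp: BijGroup_def subset_iff)
  qed
  then show ?thesis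
    by (auto simp: acts_transitively_on_def transitive_action_def transitive_action_axioms_def
        group_action_def)
qed

end

theory Submission
  imports Defs
begin

text \<open>Every generator of the permutation group of the extension acts on the first coordinate as a
  generator of the permutation group of \<open>X\<close>, and every generator of the latter arises in this way
  because \<open>S\<close> is non-empty. Lying over is compatible with the group operations, so the same holds
  for arbitrary elements: each permutation of the extension lies over one of \<open>X\<close>
  (\<open>perm_group_dyn_ext_projects\<close>), and each one of \<open>X\<close> lifts (\<open>perm_group_lifts\<close>). Moreover, a
  permutation lying over \<open>f\<close> maps the fibre over \<open>x\<close> \<^emph>\<open>onto\<close> the fibre over \<open>f x\<close>
  (\<open>lies_over_image_fibre\<close>), so the fibres form a system of blocks.

  The equivalence is then the usual one for an action with a block system. If the extension is
  indecomposable, transitivity on \<open>X\<close> follows by projection, and any permutation moving a point of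
  a fibre to a point of the same fibre preserves that fibre. Conversely, with a fibre over \<open>x\<close> on
  which its stabilizer is transitive, a point is moved to an arbitrary target in three steps: into
  the fibre over \<open>x\<close>, inside that fibre, and from there to the target.\<close>

section \<open>Relations between generated groups\<close>

text \<open>The hypotheses make \<open>R\<close> behave like a subgroup of the product of the two groups.
  Since \<open>R\<close> need not be functional, the lemma applies both to lying over and to its converse,
  which yields projection and lifting.\<close>

lemma generate_transfer:
  assumes gen: "\<And>a. a \<in> A \<Longrightarrow> \<exists>b\<in>B. R a b"
    and one: "R \<one>\<^bsub>G\<^esub> \<one>\<^bsub>H\<^esub>"
    and inv: "\<And>a b. R a b \<Longrightarrow> R (inv\<^bsub>G\<^esub> a) (inv\<^bsub>H\<^esub> b)"
    and mult: "\<And>a a' b b'. \<lbrakk>R a b; R a' b'\<rbrakk> \<Longrightarrow> R (a \<otimes>\<^bsub>G\<^esub> a') (b \<otimes>\<^bsub>H\<^esub> b')"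
    and "g \<in> generate G A"
  shows "\<exists>h\<in>generate H B. R g h"
  using \<open>g \<in> generate G A\<close>
proof induction
  case one
  show ?case using assms(2) generate.one by blast
next
  case (incl a)
  then show ?case using gen generate.incl by metis
next
  case (inv a)
  then show ?case using gen assms(3) generate.inv by metis
next
  case (eng g g')
  then show ?case using mult generate.eng by metis
qed

section \<open>Permutations of a product lying over permutations of the base\<close>

definition lies_over :: "'a set \<Rightarrow> 's set \<Rightarrow> ('a \<times> 's \<Rightarrow> 'a \<times> 's) \<Rightarrow> ('a \<Rightarrow> 'a) \<Rightarrow> bool"
  where "lies_over A S g f \<longleftrightarrow>
    g \<in> Bij (A \<times> S) \<and> f \<in> Bij A \<and> (\<forall>x\<in>A. \<forall>s\<in>S. fst (g (x, s)) = f x)"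

text \<open>Surjectivity of \<open>g\<close> provides a preimage of a point over \<open>f x\<close>, and injectivity of \<open>f\<close>
  forces this preimage to lie over \<open>x\<close>.\<close>

lemma lies_over_image_fibre:
  assumes "lies_over A S g f" "x \<in> A"
  shows "g ` ({x} \<times> S) = {f x} \<times> S"
proof
  have g: "g ` (A \<times> S) = A \<times> S" and f: "inj_on f A"
    and over: "\<And>y s. \<lbrakk>y \<in> A; s \<in> S\<rbrakk> \<Longrightarrow> fst (g (y, s)) = f y"
    using assms(1) by (auto simp: lies_over_def Bij_def bij_betw_def)
  have fx: "f x \<in> A"
    using assms by (auto simp: lies_over_def Bij_def bij_betw_def)
  show "g ` ({x} \<times> S) \<subseteq> {f x} \<times> S"
  proof
    fix q assume "q \<in> g ` ({x} \<times> S)"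
    then obtain s where s: "s \<in> S" "q = g (x, s)" by blast
    then have "q \<in> A \<times> S" using g assms(2) by blast
    with s over[OF assms(2)] show "q \<in> {f x} \<times> S" by (auto simp: mem_Times_iff)
  qed
  show "{f x} \<times> S \<subseteq> g ` ({x} \<times> S)"
  proof
    fix q assume q: "q \<in> {f x} \<times> S"
    then have "q \<in> g ` (A \<times> S)" using g fx by blast
    then obtain y s where y: "y \<in> A" "s \<in> S" "q = g (y, s)" by blast
    then have "f y = f x" using over q by force
    then have "y = x" using f y(1) assms(2) by (auto dest: inj_onD)
    with y show "q \<in> g ` ({x} \<times> S)" by blast
  qed
qed

lemma lies_over_one: "lies_over A S \<one>\<^bsub>BijGroup (A \<times> S)\<^esub> \<one>\<^bsub>BijGroup A\<^esub>"
  using id_Bij[of A] id_Bij[of "A \<times> S"] by (auto simp: lies_over_def BijGroup_def)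

lemma lies_over_mult:
  assumes "lies_over A S g f" "lies_over A S g' f'"
  shows "lies_over A S (g \<otimes>\<^bsub>BijGroup (A \<times> S)\<^esub> g') (f \<otimes>\<^bsub>BijGroup A\<^esub> f')"
proof -
  have B: "g \<in> Bij (A \<times> S)" "g' \<in> Bij (A \<times> S)" "f \<in> Bij A" "f' \<in> Bij A"
    using assms by (auto simp: lies_over_def)
  have "fst (g (g' (x, s))) = f (f' x)" if "x \<in> A" "s \<in> S" for x s
  proof -
    have "g' (x, s) \<in> {f' x} \<times> S"
      using lies_over_image_fibre[OF assms(2) \<open>x \<in> A\<close>] that by blast
    moreover have "f' x \<in> A"
      using B(4) that by (auto simp: Bij_def bij_betw_def)
    ultimately show ?thesis
      using assms(1) by (auto simp: lies_over_def)
  qed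
  then show ?thesis
    using B by (auto simp: lies_over_def BijGroup_def compose_Bij) (simp add: compose_def)
qed

lemma lies_over_inv:
  assumes "lies_over A S g f"
  shows "lies_over A S (inv\<^bsub>BijGroup (A \<times> S)\<^esub> g) (inv\<^bsub>BijGroup A\<^esub> f)"
proof -
  have B: "g \<in> Bij (A \<times> S)" "f \<in> Bij A" using assms by (auto simp: lies_over_def)
  have "fst (inv_into (A \<times> S) g (x, s)) = inv_into A f x" if "x \<in> A" "s \<in> S" for x s
  proof -
    have "(x, s) \<in> g ` (A \<times> S)" using B(1) that by (simp add: Bij_def bij_betw_def)
    then obtain y t where y: "y \<in> A" "t \<in> S" "g (y, t) = (x, s)" by auto
    have "inv_into (A \<times> S) g (x, s) = (y, t)"
      using B(1) y by (auto simp: Bij_def bij_betw_def intro!: inv_into_f_eq)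
    moreover have "f y = x" using assms y by (auto simp: lies_over_def dest!: bspec)
    then have "inv_into A f x = y"
      using B(2) y by (auto simp: Bij_def bij_betw_def intro!: inv_into_f_eq)
    ultimately show ?thesis by simp
  qed
  then show ?thesis
    using B by (simp add: lies_over_def inv_BijGroup restrict_inv_into_Bij)
qed

section \<open>Permutation groups of dynamical extensions\<close>

lemma (in regular_q_cycle_set) perm_group_image_carrier:
  assumes "h \<in> perm_group X"
  shows "h ` carrier X = carrier X"
  using subgroup.subset[OF perm_group_subgroup] assms
  by (auto simp: BijGroup_def Bij_def bij_betw_def)

context
  fixes X :: "'a q_cycle_struct" and S :: "'s set"
    and \<alpha> \<alpha>' :: "'a \<Rightarrow> 'a \<Rightarrow> 's \<Rightarrow> 's \<Rightarrow> 's"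
  assumes regX: "regular_q_cycle_set X" and S_nonempty: "S \<noteq> {}"
    and regE: "regular_q_cycle_set (dyn_ext X S \<alpha> \<alpha>')"
begin

lemma carrier_dyn_ext: "carrier (dyn_ext X S \<alpha> \<alpha>') = carrier X \<times> S"
  by (simp add: dyn_ext_def)

lemma sigma_delta_lies_over:
  assumes "x \<in> carrier X" "s \<in> S"
  shows "lies_over (carrier X) S (sigma (dyn_ext X S \<alpha> \<alpha>') (x, s)) (sigma X x)"
    and "lies_over (carrier X) S (delta (dyn_ext X S \<alpha> \<alpha>') (x, s)) (delta X x)"
proof -
  interpret X: regular_q_cycle_set X by (rule regX)
  interpret E: regular_q_cycle_set "dyn_ext X S \<alpha> \<alpha>'" by (rule regE)
  have "sigma X x \<in> Bij (carrier X)" "delta X x \<in> Bij (carrier X)"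
    using X.dot_bij X.colon_bij assms by (auto simp: Bij_def sigma_def delta_def)
  moreover have "sigma (dyn_ext X S \<alpha> \<alpha>') (x, s) \<in> Bij (carrier X \<times> S)"
    "delta (dyn_ext X S \<alpha> \<alpha>') (x, s) \<in> Bij (carrier X \<times> S)"
    using E.dot_bij[of "(x, s)"] E.colon_bij[of "(x, s)"] assms
    by (auto simp: Bij_def sigma_def delta_def carrier_dyn_ext)
  ultimately show "lies_over (carrier X) S (sigma (dyn_ext X S \<alpha> \<alpha>') (x, s)) (sigma X x)"
    and "lies_over (carrier X) S (delta (dyn_ext X S \<alpha> \<alpha>') (x, s)) (delta X x)"
    by (auto simp: lies_over_def sigma_def delta_def dyn_ext_def)
qed

lemma perm_group_dyn_ext_projects:
  assumes "g \<in> perm_group (dyn_ext X S \<alpha> \<alpha>')"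
  shows "\<exists>f\<in>perm_group X. lies_over (carrier X) S g f"
  unfolding perm_group_def
proof (rule generate_transfer[where R = "lies_over (carrier X) S"])
  show "g \<in> generate (BijGroup (carrier X \<times> S))
      (sigma (dyn_ext X S \<alpha> \<alpha>') ` (carrier X \<times> S) \<union> delta (dyn_ext X S \<alpha> \<alpha>') ` (carrier X \<times> S))"
    using assms by (simp add: perm_group_def carrier_dyn_ext)
  show "\<exists>f\<in>sigma X ` carrier X \<union> delta X ` carrier X. lies_over (carrier X) S h f"
    if "h \<in> sigma (dyn_ext X S \<alpha> \<alpha>') ` (carrier X \<times> S) \<union>
      delta (dyn_ext X S \<alpha> \<alpha>') ` (carrier X \<times> S)" for h
    using that sigma_delta_lies_over by blast
qed (rule lies_over_one lies_over_inv lies_over_mult; assumption?)+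

lemma perm_group_lifts:
  assumes "f \<in> perm_group X"
  shows "\<exists>g\<in>perm_group (dyn_ext X S \<alpha> \<alpha>'). lies_over (carrier X) S g f"
  unfolding perm_group_def carrier_dyn_ext
proof (rule generate_transfer[where R = "\<lambda>f g. lies_over (carrier X) S g f"])
  show "f \<in> generate (BijGroup (carrier X)) (sigma X ` carrier X \<union> delta X ` carrier X)"
    using assms by (simp add: perm_group_def)
  obtain s where "s \<in> S" using S_nonempty by blast
  then show "\<exists>b\<in>sigma (dyn_ext X S \<alpha> \<alpha>') ` (carrier X \<times> S) \<union>
      delta (dyn_ext X S \<alpha> \<alpha>') ` (carrier X \<times> S). lies_over (carrier X) S b a"
    if "a \<in> sigma X ` carrier X \<union> delta X ` carrier X" for a
    using that sigma_delta_lies_over by blast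
qed (rule lies_over_one lies_over_inv lies_over_mult; assumption?)+

lemma fibre_transitive_if_transitive:
  assumes tr: "\<forall>p\<in>carrier X \<times> S. \<forall>q\<in>carrier X \<times> S. \<exists>h\<in>perm_group (dyn_ext X S \<alpha> \<alpha>'). h p = q"
    and x: "x \<in> carrier X" and pq: "p \<in> {x} \<times> S" "q \<in> {x} \<times> S"
  shows "\<exists>h\<in>set_stabilizer (perm_group (dyn_ext X S \<alpha> \<alpha>')) ({x} \<times> S). h p = q"
proof -
  have "p \<in> carrier X \<times> S" "q \<in> carrier X \<times> S" using pq x by auto
  then obtain h where h: "h \<in> perm_group (dyn_ext X S \<alpha> \<alpha>')" "h p = q" using tr by metis
  then obtain f where f: "lies_over (carrier X) S h f"
    using perm_group_dyn_ext_projects by blast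
  note fibre = lies_over_image_fibre[OF f x]
  then have "q \<in> {f x} \<times> S" using h(2) pq(1) by blast
  then have "f x = x" using pq(2) by auto
  with fibre h show ?thesis by (auto simp: set_stabilizer_def)
qed

lemma transitive_if_fibre_transitive:
  assumes trX: "\<forall>y\<in>carrier X. \<forall>z\<in>carrier X. \<exists>f\<in>perm_group X. f y = z"
    and x: "x \<in> carrier X"
    and tr: "\<forall>p\<in>{x} \<times> S. \<forall>q\<in>{x} \<times> S.
      \<exists>h\<in>set_stabilizer (perm_group (dyn_ext X S \<alpha> \<alpha>')) ({x} \<times> S). h p = q"
    and pq: "p \<in> carrier X \<times> S" "q \<in> carrier X \<times> S"
  shows "\<exists>h\<in>perm_group (dyn_ext X S \<alpha> \<alpha>'). h p = q"
proof -
  let ?E = "dyn_ext X S \<alpha> \<alpha>'"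
  interpret E: regular_q_cycle_set ?E by (rule regE)
  have G: "subgroup (perm_group ?E) (BijGroup (carrier X \<times> S))"
    using E.perm_group_subgroup by (simp add: carrier_dyn_ext)
  then have BijE: "perm_group ?E \<subseteq> Bij (carrier X \<times> S)"
    using subgroup.subset by (force simp: BijGroup_def)
  obtain y s z t where p: "p = (y, s)" "y \<in> carrier X" "s \<in> S"
    and q: "q = (z, t)" "z \<in> carrier X" "t \<in> S" using pq by blast
  obtain f\<^sub>1 where f1: "f\<^sub>1 \<in> perm_group X" "f\<^sub>1 y = x" using trX p x by blast
  obtain f\<^sub>2 where f2: "f\<^sub>2 \<in> perm_group X" "f\<^sub>2 x = z" using trX q x by blast
  obtain g\<^sub>1 where g1: "g\<^sub>1 \<in> perm_group ?E" "lies_over (carrier X) S g\<^sub>1 f\<^sub>1"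
    using perm_group_lifts f1 by blast
  obtain g\<^sub>2 where g2: "g\<^sub>2 \<in> perm_group ?E" "lies_over (carrier X) S g\<^sub>2 f\<^sub>2"
    using perm_group_lifts f2 by blast
  have "g\<^sub>1 p \<in> {x} \<times> S"
    using lies_over_image_fibre[OF g1(2) p(2)] f1(2) p by blast
  moreover have "q \<in> g\<^sub>2 ` ({x} \<times> S)"
    using lies_over_image_fibre[OF g2(2) x] f2(2) q by simp
  then obtain q' where q': "q' \<in> {x} \<times> S" "g\<^sub>2 q' = q" by blast
  ultimately have "\<exists>h\<in>set_stabilizer (perm_group ?E) ({x} \<times> S). h (g\<^sub>1 p) = q'"
    using tr by metis
  then obtain h where h: "h \<in> perm_group ?E" "h (g\<^sub>1 p) = q'"
    by (auto simp: set_stabilizer_def)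
  let ?k = "g\<^sub>2 \<otimes>\<^bsub>BijGroup (carrier X \<times> S)\<^esub> (h \<otimes>\<^bsub>BijGroup (carrier X \<times> S)\<^esub> g\<^sub>1)"
  have "?k \<in> perm_group ?E"
    using subgroup.m_closed[OF G] g1(1) g2(1) h(1) by blast
  moreover have "?k p = g\<^sub>2 (h (g\<^sub>1 p))"
    using pq(1) BijE g1(1) g2(1) h(1)
    by (simp add: BijGroup_def subset_iff compose_Bij compose_eq)
  ultimately show ?thesis using h(2) q'(2) by auto
qed

end

section \<open>Indecomposability of dynamical extensions\<close>

theorem theorem2p5:
  fixes X :: "'a q_cycle_struct" and S :: "'s set"
    and \<alpha> \<alpha>' :: "'a \<Rightarrow> 'a \<Rightarrow> 's \<Rightarrow> 's \<Rightarrow> 's"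
  assumes "regular_q_cycle_set X" and "finite (carrier X)"
    and "finite S" and "S \<noteq> {}"
    and "dynamical_pair X S \<alpha> \<alpha>'"
    and "\<And>x y s. \<lbrakk>x \<in> carrier X; y \<in> carrier X; s \<in> S\<rbrakk> \<Longrightarrow> bij_betw (\<alpha>' x y s) S S"
  shows "indecomposable (dyn_ext X S \<alpha> \<alpha>') \<longleftrightarrow>
    indecomposable X \<and>
    (\<exists>x\<in>carrier X.
      acts_transitively_on (carrier (dyn_ext X S \<alpha> \<alpha>'))
        (set_stabilizer (perm_group (dyn_ext X S \<alpha> \<alpha>')) ({x} \<times> S)) ({x} \<times> S))"
proof -
  let ?E = "dyn_ext X S \<alpha> \<alpha>'"
  let ?H = "\<lambda>x. set_stabilizer (perm_group ?E) ({x} \<times> S)"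
  interpret X: regular_q_cycle_set X by fact
  have regE: "regular_q_cycle_set ?E"
    using dynamical_pair.regular_q_cycle_set_dyn_ext assms by blast
  then interpret E: regular_q_cycle_set ?E .
  note facts = assms(1,4) regE
  have carrier: "carrier ?E = carrier X \<times> S"
    by (simp add: dyn_ext_def)
  have indec_X: "indecomposable X \<longleftrightarrow>
      (\<forall>y\<in>carrier X. \<forall>z\<in>carrier X. \<exists>f\<in>perm_group X. f y = z)"
    unfolding indecomposable_def using X.perm_group_subgroup X.perm_group_image_carrier
    by (intro acts_transitively_on_iff) auto
  have indec_E: "indecomposable ?E \<longleftrightarrow>
      (\<forall>p\<in>carrier X \<times> S. \<forall>q\<in>carrier X \<times> S. \<exists>h\<in>perm_group ?E. h p = q)"
    unfolding indecomposable_def carrier[symmetric]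
    using E.perm_group_subgroup E.perm_group_image_carrier
    by (intro acts_transitively_on_iff) auto
  have fibre_iff: "acts_transitively_on (carrier ?E) (?H x) ({x} \<times> S) \<longleftrightarrow>
      (\<forall>p\<in>{x} \<times> S. \<forall>q\<in>{x} \<times> S. \<exists>h\<in>?H x. h p = q)" if "x \<in> carrier X" for x
  proof (rule acts_transitively_on_iff)
    show "{x} \<times> S \<subseteq> carrier ?E" using that carrier by auto
    then show "subgroup (?H x) (BijGroup (carrier ?E))"
      by (rule set_stabilizer_subgroup[OF E.perm_group_subgroup])
  qed (simp add: set_stabilizer_def)
  show ?thesis
  proof
    assume "indecomposable ?E"
    then have tr: "\<forall>p\<in>carrier X \<times> S. \<forall>q\<in>carrier X \<times> S. \<exists>h\<in>perm_group ?E. h p = q"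
      using indec_E by blast
    obtain s where s: "s \<in> S" using assms(4) by blast
    have "\<exists>f\<in>perm_group X. f y = z" if "y \<in> carrier X" "z \<in> carrier X" for y z
    proof -
      have "(y, s) \<in> carrier X \<times> S" "(z, s) \<in> carrier X \<times> S" using that s by auto
      then obtain h where h: "h \<in> perm_group ?E" "h (y, s) = (z, s)" using tr by metis
      obtain f where "f \<in> perm_group X" "lies_over (carrier X) S h f"
        using perm_group_dyn_ext_projects[OF facts h(1)] by blast
      moreover from this have "f y = z" using h(2) that s by (force simp: lies_over_def)
      ultimately show ?thesis by blast
    qed
    moreover obtain x where "x \<in> carrier X" using X.nonempty by blast
    ultimately show "indecomposable X \<and>
        (\<exists>x\<in>carrier X. acts_transitively_on (carrier ?E) (?H x) ({x} \<times> S))"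
      using fibre_iff indec_X fibre_transitive_if_transitive[OF facts tr] by blast
  next
    assume "indecomposable X \<and>
        (\<exists>x\<in>carrier X. acts_transitively_on (carrier ?E) (?H x) ({x} \<times> S))"
    then show "indecomposable ?E"
      using indec_E indec_X fibre_iff transitive_if_fibre_transitive[OF facts] by auto
  qed
qed

end
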